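(* Let $(Q,+)$ be a group, $\varphi,\psi\in Aut(Q,+)$, and $\alpha,\gamma\in S_Q$. The right linear quasigroups $(Q,\cdot)$ and $(Q,\circ)$ given by $x\cdot y=\alpha x+\varphi y$ and $x\circ y=\gamma x+\psi y$ are orthogonal if and only if the mapping $(\varphi^{-1}\alpha-\psi^{-1}\gamma)$, i.e. $x\mapsto\varphi^{-1}\alpha x-\psi^{-1}\gamma x$, is a permutation of the set $Q$.
   Context: Groups are written additively but need not be commutative. $S_Q$ is the set of all permutations (bijections) of the set $Q$. Products of maps are compositions, $(\alpha\beta)x=\alpha(\beta x)$. Two quasigroups $(Q,\cdot)$ and $(Q,\circ)$ on the same set are orthogonal if for all $a,b\in Q$ the system $x\cdot y=a$, $x\circ y=b$ has a unique solution $(x,y)\in Q\times Q$. A quasigroup of the form $x\cdot y=\alpha x+\varphi y$ with $\alpha\in S_Q$, $\varphi\in Aut(Q,+)$ is called right linear. *)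

theory Defs
  imports "HOL-Algebra.Group"
begin

definition quasigroup :: "'a set \<Rightarrow> ('a \<Rightarrow> 'a \<Rightarrow> 'a) \<Rightarrow> bool" where
  "quasigroup Q f \<longleftrightarrow>
     (\<forall>x\<in>Q. \<forall>y\<in>Q. f x y \<in> Q) \<and>
     (\<forall>a\<in>Q. \<forall>b\<in>Q. (\<exists>!x\<in>Q. f a x = b) \<and> (\<exists>!y\<in>Q. f y a = b))"

(* Uniqueness of the solution is stated for the pair; a nested unique existence
   over x and then y would be a different condition. *)
definition orthogonal_quasigroups ::
    "'a set \<Rightarrow> ('a \<Rightarrow> 'a \<Rightarrow> 'a) \<Rightarrow> ('a \<Rightarrow> 'a \<Rightarrow> 'a) \<Rightarrow> bool" where
  "orthogonal_quasigroups Q f g \<longleftrightarrow>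
     quasigroup Q f \<and> quasigroup Q g \<and>
     (\<forall>a\<in>Q. \<forall>b\<in>Q. \<exists>!p\<in>Q \<times> Q. f (fst p) (snd p) = a \<and> g (fst p) (snd p) = b)"

end

theory Submission
  imports Defs
begin

(* Pulling the two equations back along \<phi> and \<psi> turns the system into A x + y = u, C x + y = v with
   A = \<phi>\<inverse>\<alpha> and C = \<psi>\<inverse>\<gamma>. Subtracting cancels y on the right without using commutativity,
   leaving A x - C x = u - v, and then y = -C x + v is determined by x. *)

text \<open>Passes between bijectivity and unique solvability, both for the quasigroup laws and for
  the final criterion. The assumption on \<open>f\<close> excludes points of \<open>A\<close> sent
  outside \<open>B\<close>, about which unique solvability over \<open>B\<close> says
  nothing.\<close>

lemma bij_betw_iff_ex1:
  assumes "f \<in> A \<rightarrow> B"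
  shows "bij_betw f A B \<longleftrightarrow> (\<forall>b\<in>B. \<exists>!x. x \<in> A \<and> f x = b)"
proof
  assume "bij_betw f A B"
  then show "\<forall>b\<in>B. \<exists>!x. x \<in> A \<and> f x = b"
    unfolding bij_betw_def inj_on_def by blast
next
  assume ex1: "\<forall>b\<in>B. \<exists>!x. x \<in> A \<and> f x = b"
  have "inj_on f A"
  proof (rule inj_onI)
    fix x y assume "x \<in> A" "y \<in> A" "f x = f y"
    moreover have "f y \<in> B" using assms \<open>y \<in> A\<close> by auto
    ultimately show "x = y" using ex1 by blast
  qed
  moreover have "f ` A = B"
  proof
    show "f ` A \<subseteq> B" using assms by auto
    show "B \<subseteq> f ` A" using ex1 by (metis imageI subsetI)
  qed
  ultimately show "bij_betw f A B"
    by (simp add: bij_betw_def)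
qed

context group
begin

text \<open>Each one-sided equation is solved by moving the known factor across with an inverse and
  then inverting \<open>g\<close> or \<open>f\<close>. This settles the quasigroup conjuncts in the
  definition of orthogonality.\<close>

lemma quasigroup_mult_bij_betw:
  assumes "bij_betw f (carrier G) (carrier G)" "bij_betw g (carrier G) (carrier G)"
  shows "quasigroup (carrier G) (\<lambda>x y. f x \<otimes> g y)"
proof -
  have closed: "f x \<in> carrier G" "g x \<in> carrier G" if "x \<in> carrier G" for x
    using assms that by (auto dest: bij_betwE)
  have f: "\<exists>!x. x \<in> carrier G \<and> f x = c" and g: "\<exists>!x. x \<in> carrier G \<and> g x = c"
    if "c \<in> carrier G" for c
    using assms that closed by (simp_all add: bij_betw_iff_ex1)
  have "\<exists>!y. y \<in> carrier G \<and> f a \<otimes> g y = b" "\<exists>!y. y \<in> carrier G \<and> f y \<otimes> g a = b"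
    if "a \<in> carrier G" "b \<in> carrier G" for a b
  proof -
    have "f a \<otimes> g y = b \<longleftrightarrow> g y = inv f a \<otimes> b" if "y \<in> carrier G" for y
      using that \<open>a \<in> carrier G\<close> \<open>b \<in> carrier G\<close> closed by (metis inv_solve_left)
    then show "\<exists>!y. y \<in> carrier G \<and> f a \<otimes> g y = b"
      using g[of "inv f a \<otimes> b"] that closed by (simp cong: conj_cong)
    have "f y \<otimes> g a = b \<longleftrightarrow> f y = b \<otimes> inv g a" if "y \<in> carrier G" for y
      using that \<open>a \<in> carrier G\<close> \<open>b \<in> carrier G\<close> closed by (metis inv_solve_right)
    then show "\<exists>!y. y \<in> carrier G \<and> f y \<otimes> g a = b"
      using f[of "b \<otimes> inv g a"] that closed by (simp cong: conj_cong)
  qed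
  then show ?thesis
    unfolding quasigroup_def using closed by simp
qed

text \<open>Here \<open>p\<close> and \<open>q\<close> play the roles of \<open>A x\<close> and
  \<open>C x\<close> at a fixed \<open>x\<close>. The second equation determines \<open>y\<close>;
  substituting that value into the first leaves a condition free of \<open>y\<close>.\<close>

lemma mult_right_system_iff:
  assumes [simp]: "p \<in> carrier G" "q \<in> carrier G" "y \<in> carrier G" "u \<in> carrier G" "v \<in> carrier G"
  shows "p \<otimes> y = u \<and> q \<otimes> y = v \<longleftrightarrow> p \<otimes> inv q = u \<otimes> inv v \<and> y = inv q \<otimes> v"
proof -
  have y: "q \<otimes> y = v \<longleftrightarrow> y = inv q \<otimes> v"
    using assms by (metis inv_solve_left)
  have "p \<otimes> (inv q \<otimes> v) = u \<longleftrightarrow> p \<otimes> inv q = u \<otimes> inv v"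
    using inv_solve_right[of "p \<otimes> inv q" u v] by (auto simp: m_assoc)
  with y show ?thesis by auto
qed

text \<open>For fixed \<open>u\<close> and \<open>v\<close>, solution pairs correspond to solutions
  \<open>x\<close> of one equation whose right-hand side is \<open>u \<otimes> inv v\<close>, and
  these quotients run through the whole group as \<open>u\<close> and \<open>v\<close> vary.\<close>

lemma mult_right_systems_iff_bij_betw:
  assumes A: "A \<in> carrier G \<rightarrow> carrier G" and C: "C \<in> carrier G \<rightarrow> carrier G"
  shows "(\<forall>u\<in>carrier G. \<forall>v\<in>carrier G. \<exists>!p. p \<in> carrier G \<times> carrier G \<and>
            A (fst p) \<otimes> snd p = u \<and> C (fst p) \<otimes> snd p = v)
         \<longleftrightarrow> bij_betw (\<lambda>x. A x \<otimes> inv (C x)) (carrier G) (carrier G)" (is "?S \<longleftrightarrow> ?B")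
proof -
  let ?D = "\<lambda>x. A x \<otimes> inv (C x)"
  have D: "?D \<in> carrier G \<rightarrow> carrier G"
    using A C by auto
  have pair: "(\<exists>!p. p \<in> carrier G \<times> carrier G \<and> A (fst p) \<otimes> snd p = u \<and> C (fst p) \<otimes> snd p = v)
      \<longleftrightarrow> (\<exists>!x. x \<in> carrier G \<and> ?D x = u \<otimes> inv v)"
    if uv: "u \<in> carrier G" "v \<in> carrier G" for u v
  proof -
    \<comment> \<open>The solution set is the graph of
      \<open>x \<mapsto> inv (C x) \<otimes> v\<close> over the admissible \<open>x\<close>, so
      existence and uniqueness transfer along the first projection.\<close>
    have "(p \<in> carrier G \<times> carrier G \<and> A (fst p) \<otimes> snd p = u \<and> C (fst p) \<otimes> snd p = v) \<longleftrightarrow>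
        (fst p \<in> carrier G \<and> ?D (fst p) = u \<otimes> inv v) \<and> snd p = inv (C (fst p)) \<otimes> v" for p
      using A C uv mult_right_system_iff[of "A (fst p)" "C (fst p)" "snd p" u v]
      by (cases p) auto
    then show ?thesis
      by (simp add: Ex1_def) blast
  qed
  have "?S \<longleftrightarrow> (\<forall>w\<in>carrier G. \<exists>!x. x \<in> carrier G \<and> ?D x = w)" (is "_ \<longleftrightarrow> ?T")
  proof
    assume S: ?S
    show ?T
    proof
      fix w assume w: "w \<in> carrier G"
      \<comment> \<open>Choosing \<open>u = w\<close> and \<open>v = \<one>\<close> realises an
        arbitrary \<open>w\<close> as a quotient \<open>u \<otimes> inv v\<close>.\<close>
      have "\<exists>!x. x \<in> carrier G \<and> ?D x = w \<otimes> inv \<one>"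
        using bspec[OF bspec[OF S w] one_closed] unfolding pair[OF w one_closed] .
      then show "\<exists>!x. x \<in> carrier G \<and> ?D x = w"
        using w by simp
    qed
  next
    assume T: ?T
    show ?S
    proof (intro ballI)
      fix u v assume uv: "u \<in> carrier G" "v \<in> carrier G"
      then show "\<exists>!p. p \<in> carrier G \<times> carrier G \<and> A (fst p) \<otimes> snd p = u \<and> C (fst p) \<otimes> snd p = v"
        unfolding pair[OF uv] using T by simp
    qed
  qed
  with bij_betw_iff_ex1[OF D] show ?thesis by simp
qed

text \<open>The inverse of \<open>h\<close> is an injective homomorphism, so applying it to both
  sides loses nothing, distributes over the product and turns \<open>h y\<close> into
  \<open>y\<close>.\<close>

lemma iso_mult_eq_iff:
  assumes h: "h \<in> iso G G" and [simp]: "c \<in> carrier G" "y \<in> carrier G" "a \<in> carrier G"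
  shows "c \<otimes> h y = a \<longleftrightarrow> inv_into (carrier G) h c \<otimes> y = inv_into (carrier G) h a"
proof -
  let ?k = "inv_into (carrier G) h"
  have h_hom: "h \<in> hom G G" and h_bij: "bij_betw h (carrier G) (carrier G)"
    using h by (auto simp: iso_def)
  have k_hom: "?k \<in> hom G G" and k_bij: "bij_betw ?k (carrier G) (carrier G)"
    using iso_set_sym[OF h] by (auto simp: iso_def)
  have hy: "h y \<in> carrier G"
    using h_hom by (simp add: hom_in_carrier)
  have "?k (c \<otimes> h y) = ?k c \<otimes> y"
    using hom_mult[OF k_hom _ hy, of c] bij_betw_inv_into_left[OF h_bij, of y] by simp
  moreover have "?k (c \<otimes> h y) = ?k a \<longleftrightarrow> c \<otimes> h y = a"
    using k_bij hy by (auto simp: bij_betw_def inj_on_eq_iff)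
  ultimately show ?thesis by auto
qed

end

theorem theorem27:
  fixes G :: "('a, 'b) monoid_scheme" (structure)
    and \<phi> \<psi> \<alpha> \<gamma> :: "'a \<Rightarrow> 'a"
  assumes "group G"
    and "\<phi> \<in> iso G G"
    and "\<psi> \<in> iso G G"
    and "bij_betw \<alpha> (carrier G) (carrier G)"
    and "bij_betw \<gamma> (carrier G) (carrier G)"
  shows "orthogonal_quasigroups (carrier G)
           (\<lambda>x y. \<alpha> x \<otimes> \<phi> y) (\<lambda>x y. \<gamma> x \<otimes> \<psi> y)
         \<longleftrightarrow>
         bij_betw
           (\<lambda>x. inv_into (carrier G) \<phi> (\<alpha> x) \<otimes> inv (inv_into (carrier G) \<psi> (\<gamma> x)))
           (carrier G) (carrier G)"
proof -
  interpret group G by fact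
  let ?A = "\<lambda>x. inv_into (carrier G) \<phi> (\<alpha> x)" and ?C = "\<lambda>x. inv_into (carrier G) \<psi> (\<gamma> x)"
  have bij: "bij_betw \<phi> (carrier G) (carrier G)" "bij_betw \<psi> (carrier G) (carrier G)"
    using assms by (auto simp: iso_def)
  have inv_bij: "bij_betw (inv_into (carrier G) \<phi>) (carrier G) (carrier G)"
    "bij_betw (inv_into (carrier G) \<psi>) (carrier G) (carrier G)"
    using bij by (simp_all add: bij_betw_inv_into)
  have closed: "\<alpha> x \<in> carrier G" "\<gamma> x \<in> carrier G" if "x \<in> carrier G" for x
    using assms that by (auto dest: bij_betwE)
  have A: "?A \<in> carrier G \<rightarrow> carrier G" and C: "?C \<in> carrier G \<rightarrow> carrier G"
    using inv_bij closed by (auto dest: bij_betwE)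
  \<comment> \<open>The two systems are matched only for \<open>p\<close> in the carrier square;
    keeping that membership on both sides gives an equivalence valid for every \<open>p\<close>,
    usable for rewriting under the unique existence quantifier.\<close>
  have system: "(p \<in> carrier G \<times> carrier G \<and> \<alpha> (fst p) \<otimes> \<phi> (snd p) = a \<and> \<gamma> (fst p) \<otimes> \<psi> (snd p) = b)
      \<longleftrightarrow> (p \<in> carrier G \<times> carrier G \<and> ?A (fst p) \<otimes> snd p = inv_into (carrier G) \<phi> a
            \<and> ?C (fst p) \<otimes> snd p = inv_into (carrier G) \<psi> b)"
    if "a \<in> carrier G" "b \<in> carrier G" for a b p
  proof (rule conj_cong[OF refl])
    assume "p \<in> carrier G \<times> carrier G"
    then have p: "fst p \<in> carrier G" "snd p \<in> carrier G"
      by (auto simp: mem_Times_iff)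
    have "\<alpha> (fst p) \<otimes> \<phi> (snd p) = a \<longleftrightarrow> ?A (fst p) \<otimes> snd p = inv_into (carrier G) \<phi> a"
      by (rule iso_mult_eq_iff[OF assms(2) closed(1)[OF p(1)] p(2) that(1)])
    moreover have "\<gamma> (fst p) \<otimes> \<psi> (snd p) = b \<longleftrightarrow> ?C (fst p) \<otimes> snd p = inv_into (carrier G) \<psi> b"
      by (rule iso_mult_eq_iff[OF assms(3) closed(2)[OF p(1)] p(2) that(2)])
    ultimately show "\<alpha> (fst p) \<otimes> \<phi> (snd p) = a \<and> \<gamma> (fst p) \<otimes> \<psi> (snd p) = b \<longleftrightarrow>
        ?A (fst p) \<otimes> snd p = inv_into (carrier G) \<phi> a \<and> ?C (fst p) \<otimes> snd p = inv_into (carrier G) \<psi> b"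
      by (simp only:)
  qed
  let ?P = "\<lambda>u v. \<exists>!p. p \<in> carrier G \<times> carrier G \<and> ?A (fst p) \<otimes> snd p = u \<and> ?C (fst p) \<otimes> snd p = v"
  \<comment> \<open>Both quasigroup conjuncts are true, so only the solvability of the systems
    remains.\<close>
  have "orthogonal_quasigroups (carrier G) (\<lambda>x y. \<alpha> x \<otimes> \<phi> y) (\<lambda>x y. \<gamma> x \<otimes> \<psi> y) \<longleftrightarrow>
      (\<forall>a\<in>carrier G. \<forall>b\<in>carrier G. ?P (inv_into (carrier G) \<phi> a) (inv_into (carrier G) \<psi> b))"
    unfolding orthogonal_quasigroups_def
    using quasigroup_mult_bij_betw[OF assms(4) bij(1)] quasigroup_mult_bij_betw[OF assms(5) bij(2)]
    by (simp only: system simp_thms cong: ball_cong)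
  \<comment> \<open>Reindexing: as \<open>a\<close> and \<open>b\<close> run through the group, so
    do their preimages under \<open>\<phi>\<close> and \<open>\<psi>\<close>, independently of each
    other. Hence the right-hand sides may be taken as arbitrary \<open>u\<close> and
    \<open>v\<close>.\<close>
  also have "\<dots> \<longleftrightarrow> (\<forall>u\<in>inv_into (carrier G) \<phi> ` carrier G.
      \<forall>v\<in>inv_into (carrier G) \<psi> ` carrier G. ?P u v)"
    by (simp only: ball_simps)
  also have "\<dots> \<longleftrightarrow> (\<forall>u\<in>carrier G. \<forall>v\<in>carrier G. ?P u v)"
    using inv_bij by (simp add: bij_betw_imp_surj_on)
  also have "\<dots> \<longleftrightarrow> bij_betw (\<lambda>x. ?A x \<otimes> inv (?C x)) (carrier G) (carrier G)"
    by (rule mult_right_systems_iff_bij_betw[OF A C])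
  finally show ?thesis .
qed

end
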